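(* Let $K\ge 1$ be the number of clients, let $N_1,\dots,N_K$ be positive integers (client sample counts), and let $N=\sum_{k=1}^K N_k$. Let $j\in\mathcal{M}^{+}\cup\mathcal{M}^{-}$ be a constrained feature. Assume that all clients use the same scaling of feature $j$, the same spline knots $t_1<t_2<\dots<t_Q$, and the same signed-increment parameterization, so that client $k$'s feature function is the linear spline determined by a signed spline-increment vector $\psi_{k,j}=(\psi_{k,j,1},\dots,\psi_{k,j,Q})\in\mathbb{R}^Q$. Assume that each client satisfies its sign constraint: for every $k$ and every $q\in\{1,\dots,Q\}$, $\psi_{k,j,q}\ge 0$ if $j\in\mathcal{M}^{+}$, and $\psi_{k,j,q}\le 0$ if $j\in\mathcal{M}^{-}$. Let the aggregated signed-increment vector be $$\psi_j=\sum_{k=1}^K \frac{N_k}{N}\,\psi_{k,j},$$ and let $g_j$ be the feature function (linear spline on the same knots) determined by $\psi_j$. Then $g_j$ has the same monotonic direction on the shared grid: if $j\in\mathcal{M}^{+}$ then $g_j(t_1)\le g_j(t_2)\le\dots\le g_j(t_Q)$, and if $j\in\mathcal{M}^{-}$ then $g_j(t_1)\ge g_j(t_2)\ge\dots\ge g_j(t_Q)$.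
   Context: Federated additive model: the predictor has the form $f(\mathbf{x})=\beta_0+\sum_{j} g_j(x_j)$, where each $g_j:\mathbb{R}\to\mathbb{R}$ is the shape (feature) function of feature $j$. The disjoint sets $\mathcal{M}^{+}$ and $\mathcal{M}^{-}$ are the constrained features whose shape functions are required to be non-decreasing, respectively non-increasing. Signed-increment parameterization: each constrained feature is a linear spline on a fixed grid of $Q\ge 2$ knots $t_1<\dots<t_Q$ shared by all clients. A signed increment vector $\psi=(\psi_1,\dots,\psi_Q)\in\mathbb{R}^Q$ determines the spline whose values at the knots are the cumulative sums of the signed increments, $g(t_q)=c+\sum_{r=1}^{q}\psi_r$ for $q=1,\dots,Q$, with linear interpolation between consecutive knots. Here $c\in\mathbb{R}$ is an additive constant fixing the vertical level (the functions are anchored by subtracting their value at a fixed public reference point, the same for all clients). FedAvg on the increment vectors: the server forms the sample-weighted average $\sum_k (N_k/N)\psi_{k,j}$ of the clients' signed increment vectors and uses it as the increment vector of the global (aggregated) feature function. *)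

theory Defs
  imports Complex_Main
begin

text \<open>
  Vectors in \<open>\<real>\<^sup>Q\<close> are functions on \<open>nat\<close> of which only the values on \<open>{1..Q}\<close> matter.

  \<open>linear_spline Q t c \<psi> g\<close>: on the range \<open>[t 1, t Q]\<close> of the grid, \<open>g\<close> is the linear spline with
  level \<open>c\<close> and signed increments \<open>\<psi>\<close>. Outside that range \<open>g\<close> is left arbitrary, so no extrapolation
  rule is imposed.
\<close>

definition linear_spline ::
    "nat \<Rightarrow> (nat \<Rightarrow> real) \<Rightarrow> real \<Rightarrow> (nat \<Rightarrow> real) \<Rightarrow> (real \<Rightarrow> real) \<Rightarrow> bool" where
  "linear_spline Q t c \<psi> g \<longleftrightarrow>
     (\<forall>q\<in>{1..Q}. g (t q) = c + (\<Sum>r=1..q. \<psi> r)) \<and>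
     (\<forall>q\<in>{1..<Q}. \<forall>s\<in>{0..1}.
        g ((1 - s) * t q + s * t (q + 1)) = (1 - s) * g (t q) + s * g (t (q + 1)))"

definition fedavg :: "nat \<Rightarrow> (nat \<Rightarrow> nat) \<Rightarrow> (nat \<Rightarrow> nat \<Rightarrow> real) \<Rightarrow> nat \<Rightarrow> real" where
  "fedavg K n v q = (\<Sum>k=1..K. real (n k) / real (\<Sum>i=1..K. n i) * v k q)"

text \<open>On a strictly increasing grid the spline exists and is unique on the range of the grid.\<close>

lemma linear_spline_exists:
  assumes "strict_mono_on {1..Q} t"
  shows "\<exists>g. linear_spline Q t c \<psi> g"
  using assms
proof (induction Q)
  case 0
  then show ?case by (simp add: linear_spline_def)
next
  case (Suc Q)
  show ?case
  proof (cases "Q = 0")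
    case True
    then show ?thesis
      by (intro exI[of _ "\<lambda>_. c + \<psi> 1"]) (simp add: linear_spline_def)
  next
    case False
    have "strict_mono_on {1..Q} t"
      using Suc.prems by (auto simp: strict_mono_on_def)
    then obtain g where g: "linear_spline Q t c \<psi> g" using Suc.IH by blast
    have lt: "t Q < t (Suc Q)"
      using Suc.prems False by (auto simp: strict_mono_on_def)
    have le: "t q \<le> t Q" if "q \<in> {1..Q}" for q
      using Suc.prems that by (cases "q = Q") (auto simp: strict_mono_on_def intro: less_imp_le)
    define h where "h x = (if x \<le> t Q then g x
        else g (t Q) + (x - t Q) / (t (Suc Q) - t Q) * \<psi> (Suc Q))" for x
    have gv: "g (t q) = c + (\<Sum>r=1..q. \<psi> r)" if "q \<in> {1..Q}" for q
      using g that by (simp add: linear_spline_def)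
    have hq: "h (t q) = g (t q)" if "q \<in> {1..Q}" for q
      using le[OF that] by (simp add: h_def)
    have hS: "h (t (Suc Q)) = g (t Q) + \<psi> (Suc Q)"
      using lt by (simp add: h_def)
    have val: "h (t q) = c + (\<Sum>r=1..q. \<psi> r)" if "q \<in> {1..Suc Q}" for q
      using that False gv hq hS by (cases "q = Suc Q") auto
    have "h ((1 - s) * t q + s * t (q + 1)) = (1 - s) * h (t q) + s * h (t (q + 1))"
      if q: "q \<in> {1..<Suc Q}" and s: "s \<in> {0..1}" for q s
    proof (cases "q = Q")
      case True
      have eq: "(1 - s) * t Q + s * t (Suc Q) - t Q = s * (t (Suc Q) - t Q)"
        by (simp add: algebra_simps)
      show ?thesis
      proof (cases "s = 0")
        case True then show ?thesis by simp
      next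
        case s0: False
        then have "s * (t (Suc Q) - t Q) > 0" using s lt by auto
        then have "\<not> (1 - s) * t Q + s * t (Suc Q) \<le> t Q" using eq by linarith
        then have "h ((1 - s) * t Q + s * t (Suc Q)) = g (t Q) + s * \<psi> (Suc Q)"
          using lt eq by (simp add: h_def)
        then show ?thesis
          using True hS hq[of Q] False by (simp add: algebra_simps)
      qed
    next
      case qQ: False
      then have mem: "q \<in> {1..<Q}" using q by auto
      then have "q \<in> {1..Q}" "q + 1 \<in> {1..Q}" by auto
      moreover have "(1 - s) * t q + s * t (q + 1) \<le> (1 - s) * t Q + s * t Q"
        using s le calculation by (intro add_mono mult_left_mono) auto
      then have "(1 - s) * t q + s * t (q + 1) \<le> t Q" by (simp add: algebra_simps)
      then have "h ((1 - s) * t q + s * t (q + 1)) = g ((1 - s) * t q + s * t (q + 1))"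
        by (simp add: h_def)
      ultimately show ?thesis
        using g mem s hq by (simp add: linear_spline_def)
    qed
    with val have "linear_spline (Suc Q) t c \<psi> h"
      by (simp add: linear_spline_def)
    then show ?thesis by blast
  qed
qed

lemma linear_spline_unique:
  assumes "strict_mono_on {1..Q} t" "linear_spline Q t c \<psi> g" "linear_spline Q t c \<psi> h"
    and "Q \<ge> 1" "x \<in> {t 1..t Q}"
  shows "g x = h x"
  using assms(4,1,2,3,5)
proof (induction Q rule: dec_induct)
  case base
  then show ?case by (auto simp: linear_spline_def)
next
  case (step Q)
  have sub: "strict_mono_on {1..Q} t" "linear_spline Q t c \<psi> g" "linear_spline Q t c \<psi> h"
    using step.prems by (auto simp: strict_mono_on_def linear_spline_def)
  show ?case
  proof (cases "x \<le> t Q")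
    case True
    then show ?thesis using step.IH sub step.prems by auto
  next
    case False
    have lt: "t Q < t (Suc Q)"
      using step.prems(1) step.hyps by (auto simp: strict_mono_on_def)
    define s where "s = (x - t Q) / (t (Suc Q) - t Q)"
    have s: "s \<in> {0..1}" using False lt step.prems(4) by (auto simp: s_def field_simps)
    have "s * (t (Suc Q) - t Q) = x - t Q" using lt by (simp add: s_def)
    then have x: "x = (1 - s) * t Q + s * t (Q + 1)" by (simp add: algebra_simps)
    have mem: "Q \<in> {1..<Suc Q}" "Q \<in> {1..Suc Q}" "Q + 1 \<in> {1..Suc Q}"
      using step.hyps by auto
    have "g x = (1 - s) * g (t Q) + s * g (t (Q + 1))"
      unfolding x using step.prems(2) mem(1) s unfolding linear_spline_def by blast
    moreover have "h x = (1 - s) * h (t Q) + s * h (t (Q + 1))"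
      unfolding x using step.prems(3) mem(1) s unfolding linear_spline_def by blast
    moreover have "g (t Q) = h (t Q)" "g (t (Q + 1)) = h (t (Q + 1))"
      using step.prems(2,3) mem(2,3) unfolding linear_spline_def by metis+
    ultimately show ?thesis by simp
  qed
qed

end

theory Submission
  imports Defs
begin

text \<open>Knot values are cumulative sums, so the jump of a spline between neighbouring knots is a
  single increment (\<open>linear_spline_diff\<close>), and monotonicity on the grid is a sign
  condition on the increments. Vectors with entries of one sign form a convex cone; averaging with
  nonnegative weights stays inside it (\<open>fedavg_nonneg\<close>,
  \<open>fedavg_nonpos\<close>).\<close>

lemma linear_spline_diff:
  assumes "linear_spline Q t c \<psi> g" and "q \<in> {1..<Q}"
  shows "g (t (q + 1)) - g (t q) = \<psi> (q + 1)"
proof -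
  have "g (t p) = c + (\<Sum>r=1..p. \<psi> r)" if "p \<in> {1..Q}" for p
    using assms(1) that by (simp add: linear_spline_def)
  \<comment> \<open>Subtracting the two knot values cancels the level \<open>c\<close> and the first
    \<open>q\<close> increments.\<close>
  from this[of q] this[of "q + 1"] show ?thesis
    using assms(2) by simp
qed

text \<open>Each weight is a quotient of natural numbers, hence nonnegative (a zero denominator
  gives 0), so every summand keeps the sign of the client entry.\<close>

lemma fedavg_nonneg:
  assumes "\<And>k. k \<in> {1..K} \<Longrightarrow> v k q \<ge> 0"
  shows "fedavg K n v q \<ge> 0"
  unfolding fedavg_def using assms
  by (intro sum_nonneg mult_nonneg_nonneg divide_nonneg_nonneg of_nat_0_le_iff) auto

lemma fedavg_nonpos:
  assumes "\<And>k. k \<in> {1..K} \<Longrightarrow> v k q \<le> 0"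
  shows "fedavg K n v q \<le> 0"
  unfolding fedavg_def using assms
  by (intro sum_nonpos mult_nonneg_nonpos divide_nonneg_nonneg of_nat_0_le_iff) auto

theorem proposition1:
  fixes K Q :: nat and N :: "nat \<Rightarrow> nat"
    and Mplus Mminus :: "'f set" and j :: 'f
    and t :: "nat \<Rightarrow> real"
    and \<psi> :: "nat \<Rightarrow> 'f \<Rightarrow> nat \<Rightarrow> real"
    and c_client :: "nat \<Rightarrow> real" and g_client :: "nat \<Rightarrow> real \<Rightarrow> real"
    and c :: real and g :: "real \<Rightarrow> real"
  assumes "K \<ge> 1" and "Q \<ge> 2"
    and "\<And>k. k \<in> {1..K} \<Longrightarrow> N k > 0"
    and "Mplus \<inter> Mminus = {}" and "j \<in> Mplus \<union> Mminus"
    and "strict_mono_on {1..Q} t"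
    and "\<And>k. k \<in> {1..K} \<Longrightarrow> linear_spline Q t (c_client k) (\<psi> k j) (g_client k)"
    and "\<And>k q. k \<in> {1..K} \<Longrightarrow> q \<in> {1..Q} \<Longrightarrow> j \<in> Mplus \<Longrightarrow> \<psi> k j q \<ge> 0"
    and "\<And>k q. k \<in> {1..K} \<Longrightarrow> q \<in> {1..Q} \<Longrightarrow> j \<in> Mminus \<Longrightarrow> \<psi> k j q \<le> 0"
    and "linear_spline Q t c (fedavg K N (\<lambda>k. \<psi> k j)) g"
  shows "(j \<in> Mplus \<longrightarrow> (\<forall>q\<in>{1..<Q}. g (t q) \<le> g (t (q + 1)))) \<and>
         (j \<in> Mminus \<longrightarrow> (\<forall>q\<in>{1..<Q}. g (t q) \<ge> g (t (q + 1))))"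
proof (intro conjI impI ballI)
  fix q assume j: "j \<in> Mplus" and q: "q \<in> {1..<Q}"
  \<comment> \<open>The jump from \<open>t q\<close> to \<open>t (q + 1)\<close> is entry
    \<open>q + 1\<close>, not \<open>q\<close>. As \<open>q < Q\<close>, this index lies in
    \<open>{1..Q}\<close>, where the clients' sign constraint applies.\<close>
  have "fedavg K N (\<lambda>k. \<psi> k j) (q + 1) \<ge> 0"
    using assms(8) j q by (intro fedavg_nonneg) simp
  with linear_spline_diff[OF assms(10) q] show "g (t q) \<le> g (t (q + 1))" by linarith
next
  fix q assume j: "j \<in> Mminus" and q: "q \<in> {1..<Q}"
  \<comment> \<open>Same index shift, now in the cone of nonpositive vectors.\<close>
  have "fedavg K N (\<lambda>k. \<psi> k j) (q + 1) \<le> 0"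
    using assms(9) j q by (intro fedavg_nonpos) simp
  with linear_spline_diff[OF assms(10) q] show "g (t q) \<ge> g (t (q + 1))" by linarith
qed

end
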